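(* There exist infinitely many integers $n$ such that each of the five terms $n$, $n+4$, $n+8$, $n+12$, $n+16$ of the arithmetic progression with common difference $4$ can be written in the form $a^2+b^2$ with $a,b$ nonzero integers. *)

theory Defs
  imports Complex_Main
begin

end

theory Submission
  imports Defs "HOL-Library.Infinite_Set"
begin

text \<open>
  Take \<open>n = x\<^sup>2\<close>, so that \<open>n + 4\<close> and \<open>n + 16\<close> are immediate. The terms
  \<open>n + 8 = (x - 2)\<^sup>2 + (4 x + 4)\<close> and \<open>n + 12 = (x - 1)\<^sup>2 + (2 x + 11)\<close> are sums of two squares
  if \<open>4 x + 4\<close> and \<open>2 x + 11\<close> are squares. With \<open>x = 9 e\<^sup>2 - 1\<close> these numbers are \<open>(6 e)\<^sup>2\<close> and
  \<open>9 (2 e\<^sup>2 + 1)\<close>, which leaves the Pell equation \<open>f\<^sup>2 = 2 e\<^sup>2 + 1\<close>. Finally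
  \<open>n = (3 k)\<^sup>2 + (4 k)\<^sup>2\<close> if \<open>x = 5 k\<close>, and the cube \<open>99 + 70 \<surd>2\<close> of the fundamental unit
  \<open>3 + 2 \<surd>2\<close> preserves this divisibility.
\<close>

lemma unbounded_pell_solutions_mod_5:
  "\<exists>e f k :: int. e > int N \<and> f > 0 \<and> f\<^sup>2 = 2 * e\<^sup>2 + 1 \<and> 9 * e\<^sup>2 - 1 = 5 * k"
proof (induction N)
  case 0
  show ?case
    by (rule exI[of _ 2], rule exI[of _ 3], rule exI[of _ 7]) simp
next
  case (Suc N)
  then obtain e f k :: int
    where "e > int N" "f > 0" and pell: "f\<^sup>2 = 2 * e\<^sup>2 + 1" and k: "9 * e\<^sup>2 - 1 = 5 * k"
    by blast
  \<comment> \<open>These are the coefficients of (f + e sqrt 2)(99 + 70 sqrt 2).\<close>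
  let ?e = "70 * f + 99 * e" and ?f = "99 * f + 140 * e"
  have "?e > int (Suc N)" "?f > 0"
    using \<open>e > int N\<close> \<open>f > 0\<close> by simp_all
  moreover have "?f\<^sup>2 = 2 * ?e\<^sup>2 + 1"
    using pell by (simp add: power2_eq_square algebra_simps)
  \<comment> \<open>Modulo 5, \<open>?e\<close> is -e, so its square is unchanged; the witness adds
    9(\<open>?e\<close>^2 - e^2)/5 to k.\<close>
  moreover have "9 * ?e\<^sup>2 - 1 = 5 * (k + 9 * (980 * f\<^sup>2 + 2772 * f * e + 1960 * e\<^sup>2))"
    using k by (simp add: power2_eq_square algebra_simps)
  ultimately show ?case
    by blast
qed

lemma five_term_progression_sum_of_two_squares:
  fixes e f k :: int
  assumes "e > 0" "f > 0" and pell: "f\<^sup>2 = 2 * e\<^sup>2 + 1" and k: "9 * e\<^sup>2 - 1 = 5 * k"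
    and t: "t \<in> {(5 * k)\<^sup>2, (5 * k)\<^sup>2 + 4, (5 * k)\<^sup>2 + 8, (5 * k)\<^sup>2 + 12, (5 * k)\<^sup>2 + 16}"
  shows "\<exists>a b :: int. a \<noteq> 0 \<and> b \<noteq> 0 \<and> t = a\<^sup>2 + b\<^sup>2"
proof -
  have "e\<^sup>2 > 0"
    using \<open>e > 0\<close> by simp
  then have "k > 0"
    using k by linarith
  have "(5 * k)\<^sup>2 = (3 * k)\<^sup>2 + (4 * k)\<^sup>2" "(5 * k)\<^sup>2 + 4 = (5 * k)\<^sup>2 + 2\<^sup>2"
    "(5 * k)\<^sup>2 + 16 = (5 * k)\<^sup>2 + 4\<^sup>2"
    by (simp_all add: power2_eq_square)
  moreover have "(5 * k)\<^sup>2 + 8 = (5 * k - 2)\<^sup>2 + (6 * e)\<^sup>2"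
    using k by (simp add: power2_eq_square algebra_simps)
  moreover have "(5 * k)\<^sup>2 + 12 = (5 * k - 1)\<^sup>2 + (3 * f)\<^sup>2"
    using k pell by (simp add: power2_eq_square algebra_simps)
  \<comment> \<open>Since k is a positive integer, 5k is at least 5, so subtracting 1 or 2 cannot
    give 0.\<close>
  moreover have "3 * k \<noteq> 0" "4 * k \<noteq> 0" "5 * k \<noteq> 0" "5 * k - 2 \<noteq> 0" "5 * k - 1 \<noteq> 0"
    "6 * e \<noteq> 0" "3 * f \<noteq> 0" "(2 :: int) \<noteq> 0" "(4 :: int) \<noteq> 0"
    using \<open>k > 0\<close> \<open>e > 0\<close> \<open>f > 0\<close> by linarith+
  ultimately show ?thesis
    using t by (elim insertE emptyE) metis+
qed

theorem theorem3p4: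
  shows "infinite {n :: int. \<forall>t \<in> {n, n + 4, n + 8, n + 12, n + 16}.
           \<exists>a b :: int. a \<noteq> 0 \<and> b \<noteq> 0 \<and> t = a\<^sup>2 + b\<^sup>2}"
  unfolding infinite_int_iff_unbounded
proof
  fix m :: int
  obtain e f k :: int
    where "e > int (nat m)" "f > 0" "f\<^sup>2 = 2 * e\<^sup>2 + 1" and k: "9 * e\<^sup>2 - 1 = 5 * k"
    using unbounded_pell_solutions_mod_5 by blast
  then have "e > 0" "e > m"
    by linarith+
  \<comment> \<open>The chain m < e \<le> 9e^2 - 1 = 5k \<le> (5k)^2 makes n exceed any bound
    m.\<close>
  have "e \<le> e\<^sup>2"
    using \<open>e > 0\<close> by (simp add: self_le_power)
  then have "e \<le> 5 * k"
    using k \<open>e > 0\<close> by linarith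
  also have "\<dots> \<le> (5 * k)\<^sup>2"
    using \<open>e > 0\<close> \<open>e \<le> 5 * k\<close> by (intro self_le_power) linarith+
  finally have "m < \<bar>(5 * k)\<^sup>2\<bar>"
    using \<open>e > m\<close> by simp
  then show "\<exists>n. m < \<bar>n\<bar> \<and> n \<in> {n :: int. \<forall>t \<in> {n, n + 4, n + 8, n + 12, n + 16}.
           \<exists>a b :: int. a \<noteq> 0 \<and> b \<noteq> 0 \<and> t = a\<^sup>2 + b\<^sup>2}"
    using five_term_progression_sum_of_two_squares
      [OF \<open>e > 0\<close> \<open>f > 0\<close> \<open>f\<^sup>2 = 2 * e\<^sup>2 + 1\<close> k] by blast
qed

end
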